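(* Let $\Gamma$ be a game of the extensive form with unawareness and let $i \in I$ be a player. If player $i$ has perfect recall, i.e. whenever $i$ is active at two distinct nodes $n_1, n_k$ and there is a path $n_1, n_2, \dots, n_k$ along which $i$ takes action $a_i$ at $n_1$, then for every $n' \in h_i(n_k)$ there are a node $n'_1 \neq n'$ and a path $n'_1, \dots, n'_\ell = n'$ such that $h_i(n'_1) = h_i(n_1)$ and $i$ takes action $a_i$ at $n'_1$ along it, then for every mixed strategy $\sigma_i \in \Delta(S_i)$ of player $i$ there exists a behavior strategy $\beta_i \in B_i$ that is equivalent to $\sigma_i$, i.e. such that $\rho(n \mid \sigma_i, s_{-i}) = \rho(n \mid \beta_i, s_{-i})$ for every node $n \in \mathbf{N}$ and every profile $s_{-i} \in S_{-i}$ of pure strategies of the other players (including nature, if any).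
   Context: **Base tree.** $I$ is a finite set of players, $0$ denotes nature (possibly absent), and $I^0$ is the set of players including nature. $\bar T$ is a finite rooted directed tree with node set $\bar N = \bar D \cup \bar Z$ (disjoint; $\bar D \neq \emptyset$ decision nodes, $\bar Z$ terminal nodes) and precedence relation $\bar\lessdot$. Each $n \in \bar D$ has a nonempty set $P(n) \subseteq I^0$ of active players, each $i \in P(n)$ has a nonempty finite action set $A_i(n)$, and there is a bijection $\psi_n$ from $\prod_{i \in P(n)} A_i(n)$ onto the immediate successors of $n$. Terminal nodes have no successors and carry payoffs $(u_i(z))_{i\in I}$. **Forest.** A subtree $T$ of $\bar T$ is given by a set of nodes $N \subseteq \bar N$ with $N \cap \bar D \neq \emptyset$ such that $N$ with the restricted precedence relation is a tree. Write $T' \preceq T''$ if the nodes of $T'$ are a subset of the nodes of $T''$. $\mathbf{T}$ is a finite join-semilattice (under $\preceq$) of subtrees of $\bar T$, with top element $\bar T \in \mathbf{T}$, such that: (0) if $n \,\bar\lessdot\, n' \,\bar\lessdot\, n''$ and $n, n''$ are in $T \in \mathbf{T}$, then $n'$ is in $T$; (1) all terminal nodes of each $T \in \mathbf{T}$ are in $\bar Z$; (2) for every $T \in \mathbf{T}$, decision node $n \in T$ and $i \in P(n)$ there is a nonempty $A_i^T(n) \subseteq A_i(n)$ such that $\psi_n$ maps $\prod_{i \in P(n)} A_i^T(n)$ bijectively onto the immediate successors of $n$ in $T$; (3) for any $T\in\mathbf{T}$ and decision nodes $n,n' \in T$ with $i \in P(n)\cap P(n')$, if $A_i(n) \cap A_i(n')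 \neq \emptyset$ then $A_i(n) = A_i(n')$. Appearances of the same node in different trees are treated as distinct objects: $n_T$ is the copy in $T$ of a node $n$ (if it exists in $T$), copies commute ($(n_{T'})_T = n_T$), and $n_T = n$ if $n \in T$. $\mathbf{N}$ and $\mathbf{D}$ are the disjoint unions over $T \in \mathbf{T}$ of all nodes and of all decision nodes; $\mathbf{D}_i$ is the set of nodes in $\mathbf{D}$ at which $i$ is active; $T_n$ is the tree containing $n \in \mathbf{N}$. For a node $n$ of a tree $T$, $A_i(n)$ denotes the actions available at $n$ in $T$, i.e. $A_i^T(n)$. Paths are directed paths within one tree. **Information sets.** For each $n \in \mathbf{D}$ and $i \in P(n)\setminus\{0\}$ there is a nonempty information set $h_i(n) \subseteq \mathbf{D}_i$ such that: (I2) if $n' \in h_i(n)$ then $h_i(n') = h_i(n)$; (I3) if $n' \in h_i(n) \subseteq T'$ and there is a path $n',\dots,n''$ in $T'$ with $i \in P(n') \cap P(n'')$, then $h_i(n'') \subseteq T'$; (I4) if $n' \in h_i(n)$ then $A_i(n') \subseteq A_i(n)$; (I5) for $T \in \mathbf{T}$ and decision nodes $n,n' \in T$, if $A_i(n) = A_i(n')$ then $h_i(n') = h_i(n)$; (U0) if $n \in T$ and $i \in P(n)$, there is $T' \in \mathbf{T}$, $T' \preceq T$, with $h_i(n) \subseteq T'$; (U1) if $n \in T$ and $h_i(n) \subseteq T'$, then the copy $n_{T'}$ exists and $n_{T'} \in h_i(n)$; (U4) if $T \preceq T' \preceq T''$, $n \in T''$, $h_i(n) \subseteq T$ and $T'$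 contains the copy $n_{T'}$, then $h_i(n_{T'}) = h_i(n)$; (U5) if $T \preceq T' \preceq T''$, $n \in T''$, $h_i(n) \subseteq T'$ and $T$ contains the copy $n_T$, then $h_i(n_T)$ consists of the copies that exist in $T$ of the nodes of $h_i(n)$. These data form a *game of the extensive form with unawareness* $\Gamma$. $H_i$ is the set of all information sets of player $i$ (in all trees). All nodes in an information set $h_i$ have the same action set for $i$, written $A_i(h_i)$. **Perfect recall (I6) for player $i$:** if $i$ is active at two distinct nodes $n_1, n_k$ and there is a path $n_1, n_2, \dots, n_k$ along which $i$ takes action $a_i$ at $n_1$, then for every $n' \in h_i(n_k)$ there are a node $n'_1 \neq n'$ and a path $n'_1, \dots, n'_\ell = n'$ such that $h_i(n'_1) = h_i(n_1)$ and $i$ takes action $a_i$ at $n'_1$ along it. **Strategies.** Pure strategies: $S_i = \prod_{h_i \in H_i} A_i(h_i)$ for $i \in I$, and $S_0 = \prod_{n \in \mathbf{D}_0} A_0(n)$ for nature; $S_{-i} = \prod_{j \in I^0\setminus\{i\}} S_j$. Under $s_i$, player $i \in I$ plays $s_i(h_i(n))$ at every node $n \in \mathbf{D}_i$ (even if $h_i(n)$ lies in a tree other than $T_n$); nature plays $s_0(n)$ at $n$. Mixed strategies: $\sigma_i \in \Delta(S_i)$. Behavior strategies of $i \in I$: $\beta_i \in B_i = \prod_{h_i \in H_i} \Delta(A_i(h_i))$; the mixed action at $n \in \mathbf{D}_i$ is $\beta_i(h_i(n))$ (actions outside $A_i(h_i(n))$ get probability $0$), with independent randomization across nodes. **Reaching.**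 A pure profile $s$ reaches a node $n \in T$ if $n$ lies on the path in $T$ that starts at the root of $T$ and follows the actions prescribed by $s$ at each node of $T$. $\rho(n \mid \sigma_i, s_{-i})$ is the $\sigma_i$-probability of the set of $s_i$ such that $(s_i, s_{-i})$ reaches $n$. $\rho(n \mid \beta_i, s_{-i})$ is the probability that $(\beta_i, s_{-i})$ reaches $n$: it is $0$ if at some node strictly preceding $n$ in $T_n$ the action prescribed by $s_{-i}$ for some active player other than $i$ is not the one leading towards $n$, and otherwise is the product, over the nodes $n' \in \mathbf{D}_i$ strictly preceding $n$ in $T_n$, of $\beta_i(h_i(n'))(a)$, where $a$ is $i$'s action at $n'$ leading towards $n$. *)

theory Defs
  imports "HOL-Probability.Probability_Mass_Function"
begin

section \<open>Games of the extensive form with unawareness\<close>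

datatype 'p agent = Nature | Player 'p

text \<open>
  A tree of the forest is identified with its set of nodes. The copy \<open>n\<^sub>T\<close> of a node \<open>n\<close> in the
  tree \<open>T\<close> is the pair \<open>(T, n)\<close>, and it exists iff \<open>n \<in> T\<close>. For a copy \<open>x\<close>, the tree containing it
  is \<open>fst x\<close>, and its copy in \<open>T\<close> is \<open>(T, snd x)\<close>.
\<close>

type_synonym 'v copy = "'v set \<times> 'v"

text \<open>
  The field \<open>prec\<close> is the strict precedence relation of the base tree (all predecessors, not only
  the immediate ones), \<open>move n\<close> is the map \<open>\<psi>\<^sub>n\<close>, and \<open>tree_act T n j\<close> is the set \<open>A\<^sub>j\<^sup>T(n)\<close>.
  Nature is absent from a game if it is active nowhere.
\<close>

record ('p, 'v, 'a) ugame =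
  players :: "'p set"
  decs :: "'v set"
  terms :: "'v set"
  prec :: "('v \<times> 'v) set"
  active :: "'v \<Rightarrow> 'p agent set"
  base_act :: "'v \<Rightarrow> 'p agent \<Rightarrow> 'a set"
  move :: "'v \<Rightarrow> ('p agent \<Rightarrow> 'a) \<Rightarrow> 'v"
  payoff :: "'p \<Rightarrow> 'v \<Rightarrow> real"
  forest :: "'v set set"
  tree_act :: "'v set \<Rightarrow> 'v \<Rightarrow> 'p agent \<Rightarrow> 'a set"
  info :: "'p \<Rightarrow> 'v copy \<Rightarrow> 'v copy set"

definition base :: "('p, 'v, 'a) ugame \<Rightarrow> 'v set" where
  "base G = decs G \<union> terms G"

definition is_root :: "('v \<times> 'v) set \<Rightarrow> 'v set \<Rightarrow> 'v \<Rightarrow> bool" where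
  "is_root r T n \<longleftrightarrow> n \<in> T \<and> (\<forall>m\<in>T. m \<noteq> n \<longrightarrow> (n, m) \<in> r)"

definition rooted_tree :: "'v set \<Rightarrow> ('v \<times> 'v) set \<Rightarrow> bool" where
  "rooted_tree T r \<longleftrightarrow> finite T \<and> r \<subseteq> T \<times> T \<and> irrefl r \<and> trans r \<and> (\<exists>n. is_root r T n) \<and>
     (\<forall>n\<in>T. total_on {m. (m, n) \<in> r} r)"

definition imm_succ :: "('p, 'v, 'a) ugame \<Rightarrow> 'v set \<Rightarrow> 'v \<Rightarrow> 'v set" where
  "imm_succ G T n =
     {m \<in> T. (n, m) \<in> prec G \<and> \<not> (\<exists>k\<in>T. (n, k) \<in> prec G \<and> (k, m) \<in> prec G)}"

definition subtree :: "('p, 'v, 'a) ugame \<Rightarrow> 'v set \<Rightarrow> bool" where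
  "subtree G T \<longleftrightarrow> T \<subseteq> base G \<and> T \<inter> decs G \<noteq> {} \<and> rooted_tree T (prec G \<inter> T \<times> T)"

definition nodes :: "('p, 'v, 'a) ugame \<Rightarrow> 'v copy set" where
  "nodes G = (SIGMA T:forest G. T)"

definition dec_nodes :: "('p, 'v, 'a) ugame \<Rightarrow> 'v copy set" where
  "dec_nodes G = (SIGMA T:forest G. T \<inter> decs G)"

definition active_nodes :: "('p, 'v, 'a) ugame \<Rightarrow> 'p agent \<Rightarrow> 'v copy set" where
  "active_nodes G j = {x \<in> dec_nodes G. j \<in> active G (snd x)}"

definition act :: "('p, 'v, 'a) ugame \<Rightarrow> 'p agent \<Rightarrow> 'v copy \<Rightarrow> 'a set" where
  "act G j x = tree_act G (fst x) (snd x) j"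

text \<open>\<open>in_tree h T\<close> renders \<open>h \<subseteq> T\<close> for a set \<open>h\<close> of copies.\<close>

definition in_tree :: "'v copy set \<Rightarrow> 'v set \<Rightarrow> bool" where
  "in_tree h T \<longleftrightarrow> h \<subseteq> {T} \<times> T"

definition tree_path :: "('p, 'v, 'a) ugame \<Rightarrow> 'v copy list \<Rightarrow> bool" where
  "tree_path G xs \<longleftrightarrow> xs \<noteq> [] \<and> set xs \<subseteq> nodes G \<and>
     successively (\<lambda>x y. fst y = fst x \<and> snd y \<in> imm_succ G (fst x) (snd x)) xs"

definition path_between :: "('p, 'v, 'a) ugame \<Rightarrow> 'v copy \<Rightarrow> 'v copy list \<Rightarrow> 'v copy \<Rightarrow> bool" where
  "path_between G x xs y \<longleftrightarrow> tree_path G xs \<and> hd xs = x \<and> last xs = y"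

definition joint_acts :: "('p, 'v, 'a) ugame \<Rightarrow> 'v copy \<Rightarrow> ('p agent \<Rightarrow> 'a) set" where
  "joint_acts G x = (\<Pi>\<^sub>E j\<in>active G (snd x). act G j x)"

locale unawareness_game =
  fixes G :: "('p, 'v, 'a) ugame"
  assumes finite_players: "finite (players G)"
    \<comment> \<open>base tree\<close>
    and decs_terms: "decs G \<inter> terms G = {}"
    and decs_nonempty: "decs G \<noteq> {}"
    and base_tree: "rooted_tree (base G) (prec G)"
    and active_nonempty: "n \<in> decs G \<Longrightarrow> active G n \<noteq> {}"
    and active_players: "n \<in> decs G \<Longrightarrow> active G n \<subseteq> insert Nature (Player ` players G)"
    and base_act: "\<lbrakk>n \<in> decs G; j \<in> active G n\<rbrakk> \<Longrightarrow> finite (base_act G n j) \<and> base_act G n j \<noteq> {}"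
    and move: "n \<in> decs G \<Longrightarrow>
      bij_betw (move G n) (\<Pi>\<^sub>E j\<in>active G n. base_act G n j) (imm_succ G (base G) n)"
    and terms_no_succ: "z \<in> terms G \<Longrightarrow> (z, m) \<notin> prec G"
    \<comment> \<open>forest\<close>
    and finite_forest: "finite (forest G)"
    and forest_subtree: "T \<in> forest G \<Longrightarrow> subtree G T"
    and forest_top: "base G \<in> forest G"
    and forest_join: "\<lbrakk>T1 \<in> forest G; T2 \<in> forest G\<rbrakk> \<Longrightarrow>
      \<exists>J\<in>forest G. T1 \<subseteq> J \<and> T2 \<subseteq> J \<and> (\<forall>V\<in>forest G. T1 \<subseteq> V \<longrightarrow> T2 \<subseteq> V \<longrightarrow> J \<subseteq> V)"
    and F0: "\<lbrakk>T \<in> forest G; n \<in> T; n'' \<in> T; (n, n') \<in> prec G; (n', n'') \<in> prec G\<rbrakk> \<Longrightarrow> n' \<in> T"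
    and F1: "\<lbrakk>T \<in> forest G; n \<in> T; imm_succ G T n = {}\<rbrakk> \<Longrightarrow> n \<in> terms G"
    and F2: "\<lbrakk>T \<in> forest G; n \<in> T; n \<in> decs G\<rbrakk> \<Longrightarrow>
      (\<forall>j\<in>active G n. tree_act G T n j \<noteq> {} \<and> tree_act G T n j \<subseteq> base_act G n j) \<and>
      bij_betw (move G n) (\<Pi>\<^sub>E j\<in>active G n. tree_act G T n j) (imm_succ G T n)"
    and F3: "\<lbrakk>x \<in> active_nodes G j; y \<in> active_nodes G j; fst y = fst x; act G j x \<inter> act G j y \<noteq> {}\<rbrakk>
      \<Longrightarrow> act G j x = act G j y"
    \<comment> \<open>information sets\<close>
    and info: "x \<in> active_nodes G (Player i) \<Longrightarrow>
      info G i x \<noteq> {} \<and> info G i x \<subseteq> active_nodes G (Player i)"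
    and I2: "\<lbrakk>x \<in> active_nodes G (Player i); x' \<in> info G i x\<rbrakk> \<Longrightarrow> info G i x' = info G i x"
    and I3: "\<lbrakk>x \<in> active_nodes G (Player i); x' \<in> info G i x; T \<in> forest G; in_tree (info G i x) T;
      path_between G x' xs x''; x'' \<in> active_nodes G (Player i)\<rbrakk> \<Longrightarrow> in_tree (info G i x'') T"
    and I4: "\<lbrakk>x \<in> active_nodes G (Player i); x' \<in> info G i x\<rbrakk> \<Longrightarrow>
      act G (Player i) x' \<subseteq> act G (Player i) x"
    and I5: "\<lbrakk>x \<in> active_nodes G (Player i); y \<in> active_nodes G (Player i); fst y = fst x;
      act G (Player i) x = act G (Player i) y\<rbrakk> \<Longrightarrow> info G i y = info G i x"
    and U0: "x \<in> active_nodes G (Player i) \<Longrightarrow>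
      \<exists>T'\<in>forest G. T' \<subseteq> fst x \<and> in_tree (info G i x) T'"
    and U1: "\<lbrakk>x \<in> active_nodes G (Player i); T' \<in> forest G; in_tree (info G i x) T'\<rbrakk> \<Longrightarrow>
      snd x \<in> T' \<and> (T', snd x) \<in> info G i x"
    and U4: "\<lbrakk>x \<in> active_nodes G (Player i); T \<in> forest G; T' \<in> forest G; T \<subseteq> T'; T' \<subseteq> fst x;
      in_tree (info G i x) T; snd x \<in> T'\<rbrakk> \<Longrightarrow> info G i (T', snd x) = info G i x"
    and U5: "\<lbrakk>x \<in> active_nodes G (Player i); T \<in> forest G; T' \<in> forest G; T \<subseteq> T'; T' \<subseteq> fst x;
      in_tree (info G i x) T'; snd x \<in> T\<rbrakk> \<Longrightarrow>
      info G i (T, snd x) = {(T, snd y) |y. y \<in> info G i x \<and> snd y \<in> T}"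

text \<open>
  The joint action at \<open>x\<close> leading to its immediate successor \<open>y\<close>, and the joint action at \<open>x\<close>
  leading towards a node \<open>y\<close> that it strictly precedes in the same tree.
\<close>

definition joint_act_to :: "('p, 'v, 'a) ugame \<Rightarrow> 'v copy \<Rightarrow> 'v copy \<Rightarrow> 'p agent \<Rightarrow> 'a" where
  "joint_act_to G x y = inv_into (joint_acts G x) (move G (snd x)) (snd y)"

definition joint_act_toward :: "('p, 'v, 'a) ugame \<Rightarrow> 'v copy \<Rightarrow> 'v copy \<Rightarrow> 'p agent \<Rightarrow> 'a" where
  "joint_act_toward G x y = joint_act_to G x
     (fst x, THE c. c \<in> imm_succ G (fst x) (snd x) \<and> (c = snd y \<or> (c, snd y) \<in> prec G))"

definition perfect_recall :: "('p, 'v, 'a) ugame \<Rightarrow> 'p \<Rightarrow> bool" where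
  "perfect_recall G i \<longleftrightarrow>
     (\<forall>x\<in>active_nodes G (Player i). \<forall>y\<in>active_nodes G (Player i). \<forall>xs a.
        x \<noteq> y \<and> path_between G x xs y \<and> joint_act_to G x (xs ! 1) (Player i) = a \<longrightarrow>
        (\<forall>y'\<in>info G i y. \<exists>x'\<in>active_nodes G (Player i). \<exists>xs'.
           x' \<noteq> y' \<and> path_between G x' xs' y' \<and> info G i x' = info G i x \<and>
           joint_act_to G x' (xs' ! 1) (Player i) = a))"


section \<open>Strategies\<close>

definition info_sets :: "('p, 'v, 'a) ugame \<Rightarrow> 'p \<Rightarrow> 'v copy set set" where
  "info_sets G i = info G i ` active_nodes G (Player i)"

text \<open>By (I2) and (I4), all nodes of an information set have the same action set.\<close>

definition info_act :: "('p, 'v, 'a) ugame \<Rightarrow> 'p \<Rightarrow> 'v copy set \<Rightarrow> 'a set" where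
  "info_act G i h = (THE A. \<forall>x\<in>h. act G (Player i) x = A)"

type_synonym ('v, 'a) strategy = "'v copy set \<Rightarrow> 'a"

definition pure_strategies :: "('p, 'v, 'a) ugame \<Rightarrow> 'p \<Rightarrow> ('v, 'a) strategy set" where
  "pure_strategies G i = (\<Pi>\<^sub>E h\<in>info_sets G i. info_act G i h)"

definition nature_strategies :: "('p, 'v, 'a) ugame \<Rightarrow> ('v copy \<Rightarrow> 'a) set" where
  "nature_strategies G = (\<Pi>\<^sub>E x\<in>active_nodes G Nature. act G Nature x)"

text \<open>
  A profile consists of a strategy of nature and a family of strategies of the players. If nature
  is absent, there is exactly one strategy of nature.
\<close>

type_synonym ('p, 'v, 'a) profile = "('v copy \<Rightarrow> 'a) \<times> ('p \<Rightarrow> ('v, 'a) strategy)"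

definition opponent_profiles :: "('p, 'v, 'a) ugame \<Rightarrow> 'p \<Rightarrow> ('p, 'v, 'a) profile set" where
  "opponent_profiles G i =
     nature_strategies G \<times> (\<Pi>\<^sub>E j\<in>players G - {i}. pure_strategies G j)"

definition with_strategy :: "'p \<Rightarrow> ('v, 'a) strategy \<Rightarrow> ('p, 'v, 'a) profile \<Rightarrow> ('p, 'v, 'a) profile"
  where "with_strategy i si s = (fst s, (snd s)(i := si))"

definition mixed_strategies :: "('p, 'v, 'a) ugame \<Rightarrow> 'p \<Rightarrow> ('v, 'a) strategy pmf set" where
  "mixed_strategies G i = {\<sigma>. set_pmf \<sigma> \<subseteq> pure_strategies G i}"

definition behavior_strategies :: "('p, 'v, 'a) ugame \<Rightarrow> 'p \<Rightarrow> ('v copy set \<Rightarrow> 'a pmf) set" where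
  "behavior_strategies G i = (\<Pi>\<^sub>E h\<in>info_sets G i. {p. set_pmf p \<subseteq> info_act G i h})"


section \<open>Reaching nodes\<close>

fun prescribed :: "('p, 'v, 'a) ugame \<Rightarrow> ('p, 'v, 'a) profile \<Rightarrow> 'v copy \<Rightarrow> 'p agent \<Rightarrow> 'a" where
  "prescribed G s x Nature = fst s x"
| "prescribed G s x (Player j) = snd s j (info G j x)"

inductive reaches :: "('p, 'v, 'a) ugame \<Rightarrow> ('p, 'v, 'a) profile \<Rightarrow> 'v copy \<Rightarrow> bool"
  for G s where
  root: "\<lbrakk>T \<in> forest G; is_root (prec G) T n\<rbrakk> \<Longrightarrow> reaches G s (T, n)"
| step: "\<lbrakk>reaches G s (T, n); n \<in> decs G\<rbrakk> \<Longrightarrow>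
    reaches G s (T, move G n (restrict (prescribed G s (T, n)) (active G n)))"

definition preceding :: "('p, 'v, 'a) ugame \<Rightarrow> 'v copy \<Rightarrow> 'v copy set" where
  "preceding G x = {y \<in> nodes G. fst y = fst x \<and> (snd y, snd x) \<in> prec G}"

definition reach_mixed ::
  "('p, 'v, 'a) ugame \<Rightarrow> 'p \<Rightarrow> ('v, 'a) strategy pmf \<Rightarrow> ('p, 'v, 'a) profile \<Rightarrow> 'v copy \<Rightarrow> real" where
  "reach_mixed G i \<sigma> s x =
     measure_pmf.prob \<sigma> {si \<in> pure_strategies G i. reaches G (with_strategy i si s) x}"

definition reach_behavior ::
  "('p, 'v, 'a) ugame \<Rightarrow> 'p \<Rightarrow> ('v copy set \<Rightarrow> 'a pmf) \<Rightarrow> ('p, 'v, 'a) profile \<Rightarrow> 'v copy \<Rightarrow> real" where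
  "reach_behavior G i \<beta> s x =
     (if \<exists>y\<in>preceding G x. \<exists>j\<in>active G (snd y) - {Player i}.
           prescribed G s y j \<noteq> joint_act_toward G y x j
      then 0
      else \<Prod>y\<in>preceding G x \<inter> active_nodes G (Player i).
             pmf (\<beta> (info G i y)) (joint_act_toward G y x (Player i)))"

definition equivalent_strategies ::
  "('p, 'v, 'a) ugame \<Rightarrow> 'p \<Rightarrow> ('v, 'a) strategy pmf \<Rightarrow> ('v copy set \<Rightarrow> 'a pmf) \<Rightarrow> bool" where
  "equivalent_strategies G i \<sigma> \<beta> \<longleftrightarrow>
     (\<forall>x\<in>nodes G. \<forall>s\<in>opponent_profiles G i. reach_mixed G i \<sigma> s x = reach_behavior G i \<beta> s x)"

end

theory Submission
  imports Defs
begin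

text \<open>
  The experience of player \<open>i\<close> at a node is the set of pairs (information set, action taken there)
  collected at the nodes of \<open>i\<close> that precede it. The nodes of an information set \<open>h\<close> of \<open>n\<close> may lie
  in a less expressive tree than \<open>n\<close>, so perfect recall only yields that the experience at \<open>n\<close> is
  contained in the experience at every node of \<open>h\<close>. No information set is met twice along a path, so
  the size of the experience is the number of own preceding nodes; as the copy of \<open>n\<close> in the tree of
  \<open>h\<close> has at most as many of these as \<open>n\<close>, the two experiences coincide, and the experience is a
  function of \<open>h\<close>. A behavior strategy is then obtained by letting \<open>h\<close> randomize
  according to \<open>\<sigma>\<close> conditioned on the pure strategies consistent with the experience at \<open>h\<close>, and
  the product of these conditional probabilities along a path telescopes.
\<close>

section \<open>Own predecessors, experience and consistent strategies\<close>

definition own_preceding :: "('p, 'v, 'a) ugame \<Rightarrow> 'p \<Rightarrow> 'v copy \<Rightarrow> 'v copy set" where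
  "own_preceding G i x = preceding G x \<inter> active_nodes G (Player i)"

text \<open>The pairs carry information sets instead of nodes, so that experiences at nodes of
  different trees can be compared by inclusion. The order of the moves is not recorded: inclusion,
  cardinality and consistency depend on the set alone.\<close>

definition experience :: "('p, 'v, 'a) ugame \<Rightarrow> 'p \<Rightarrow> 'v copy \<Rightarrow> ('v copy set \<times> 'a) set" where
  "experience G i x =
     (\<lambda>y. (info G i y, joint_act_toward G y x (Player i))) ` own_preceding G i x"

text \<open>A cylinder event in the full function space. Membership in
  \<open>pure_strategies\<close> is left out because a mixed strategy is supported there
  anyway.\<close>

definition consistent :: "('h \<times> 'a) set \<Rightarrow> ('h \<Rightarrow> 'a) set" where
  "consistent E = {s. \<forall>(h, a)\<in>E. s h = a}"

lemma consistent_empty [simp]: "consistent {} = UNIV"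
  by (simp add: consistent_def)

lemma consistent_insert: "consistent (insert (h, a) E) = consistent E \<inter> {s. s h = a}"
  by (auto simp: consistent_def)

context unawareness_game
begin

subsection \<open>Nodes and paths of the trees of the forest\<close>

lemma prec_trans: "(a, b) \<in> prec G \<Longrightarrow> (b, c) \<in> prec G \<Longrightarrow> (a, c) \<in> prec G"
  using base_tree unfolding rooted_tree_def trans_def by blast

lemma prec_irrefl: "(a, a) \<notin> prec G"
  using base_tree unfolding rooted_tree_def irrefl_def by blast

lemma prec_asym: "(a, b) \<in> prec G \<Longrightarrow> (b, a) \<notin> prec G"
  using prec_trans[of a b a] prec_irrefl[of a] by blast

lemma prec_base: "(a, b) \<in> prec G \<Longrightarrow> a \<in> base G \<and> b \<in> base G"
  using base_tree unfolding rooted_tree_def by blast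

lemma prec_comparable:
  assumes "(a, c) \<in> prec G" "(b, c) \<in> prec G"
  shows "a = b \<or> (a, b) \<in> prec G \<or> (b, a) \<in> prec G"
proof -
  have "total_on {m. (m, c) \<in> prec G} (prec G)"
    using base_tree prec_base[OF assms(1)] unfolding rooted_tree_def by blast
  then show ?thesis using assms unfolding total_on_def by blast
qed

lemma finite_base: "finite (base G)"
  using base_tree unfolding rooted_tree_def by blast

lemma finite_acyclic_prec: "finite (prec G)" "acyclic (prec G)"
proof -
  have "prec G \<subseteq> base G \<times> base G"
    using prec_base by auto
  then show "finite (prec G)"
    using finite_base finite_subset by blast
  have "trans (prec G)" "irrefl (prec G)"
    using base_tree unfolding rooted_tree_def by blast+
  then show "acyclic (prec G)"
    by (simp add: acyclic_irrefl)
qed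

lemma wf_prec: "wf (prec G)"
  using finite_acyclic_prec by (rule finite_acyclic_wf)

lemma wf_prec_converse: "wf ((prec G)\<inverse>)"
  using finite_acyclic_prec by (rule finite_acyclic_wf_converse)

lemma prec_minimal: "Q \<noteq> {} \<Longrightarrow> \<exists>c\<in>Q. \<forall>k. (k, c) \<in> prec G \<longrightarrow> k \<notin> Q"
  using wf_prec unfolding wf_eq_minimal by (simp add: ex_in_conv[symmetric])

lemma prec_maximal: "Q \<noteq> {} \<Longrightarrow> \<exists>c\<in>Q. \<forall>k. (c, k) \<in> prec G \<longrightarrow> k \<notin> Q"
  using wf_prec_converse unfolding wf_eq_minimal by (simp add: ex_in_conv[symmetric])

lemma tree_base: "T \<in> forest G \<Longrightarrow> T \<subseteq> base G"
  using forest_subtree unfolding subtree_def by blast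

lemma finite_nodes: "finite (nodes G)"
  unfolding nodes_def using finite_forest finite_base tree_base
  by (intro finite_SigmaI) (auto intro: finite_subset)

lemma prec_decs: "(a, b) \<in> prec G \<Longrightarrow> a \<in> decs G"
  using terms_no_succ prec_base unfolding base_def by blast

section \<open>Immediate successors and joint actions leading towards a node\<close>

lemma ex_toward:
  assumes "n \<in> T" "(m, n) \<in> prec G"
  shows "\<exists>c. c \<in> imm_succ G T m \<and> (c = n \<or> (c, n) \<in> prec G)"
proof -
  \<comment> \<open>The segment of \<open>T\<close> after \<open>m\<close> up to and including
    \<open>n\<close>; its minimal elements are immediate successors of \<open>m\<close>.\<close>
  let ?Q = "{k \<in> T. (m, k) \<in> prec G \<and> (k = n \<or> (k, n) \<in> prec G)}"
  have "?Q \<noteq> {}" using assms by blast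
  from prec_minimal[OF this] obtain c where c: "c \<in> ?Q" "\<forall>k. (k, c) \<in> prec G \<longrightarrow> k \<notin> ?Q"
    by (rule bexE)
  then have "c \<in> imm_succ G T m"
    unfolding imm_succ_def using prec_trans by blast
  with c show ?thesis by blast
qed

text \<open>Predecessors of \<open>n\<close> form a chain, and of two immediate successors of
  \<open>m\<close> neither can precede the other. This makes the \<open>THE\<close> in
  \<open>joint_act_toward\<close> well defined.\<close>

lemma toward_unique:
  assumes "c \<in> imm_succ G T m" "c = n \<or> (c, n) \<in> prec G"
    and "d \<in> imm_succ G T m" "d = n \<or> (d, n) \<in> prec G"
  shows "c = d"
proof -
  have "c = d \<or> (c, d) \<in> prec G \<or> (d, c) \<in> prec G"
    using assms(2,4) prec_comparable[of c n d] by auto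
  then show ?thesis
    using assms(1,3) by (auto simp: imm_succ_def)
qed

lemma joint_act_toward_eq:
  assumes "c \<in> imm_succ G T m" "c = n \<or> (c, n) \<in> prec G"
  shows "joint_act_toward G (T, m) (T, n) = joint_act_to G (T, m) (T, c)"
proof -
  have "(THE c. c \<in> imm_succ G T m \<and> (c = n \<or> (c, n) \<in> prec G)) = c"
    by (rule the_equality) (use assms in \<open>auto dest: toward_unique[OF assms]\<close>)
  then show ?thesis by (simp add: joint_act_toward_def)
qed

text \<open>The same immediate successor of \<open>m\<close> leads to \<open>n\<close> and to
  everything beyond \<open>n\<close>. Inductions along a path use this to change the target
  node.\<close>

lemma joint_act_toward_prec:
  assumes "n \<in> T" "(m, n) \<in> prec G" "(n, k) \<in> prec G"
  shows "joint_act_toward G (T, m) (T, k) = joint_act_toward G (T, m) (T, n)"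
proof -
  obtain c where c: "c \<in> imm_succ G T m" "c = n \<or> (c, n) \<in> prec G"
    using ex_toward[OF assms(1,2)] by blast
  have "(c, k) \<in> prec G"
    using c(2) assms(3) prec_trans by blast
  then show ?thesis
    using joint_act_toward_eq[OF c] joint_act_toward_eq[OF c(1), of k] by simp
qed

lemma bij_move:
  assumes "T \<in> forest G" "m \<in> T" "m \<in> decs G"
  shows "bij_betw (move G m) (joint_acts G (T, m)) (imm_succ G T m)"
  using F2[OF assms] unfolding joint_acts_def act_def by simp

lemma joint_act_to_succ:
  assumes "T \<in> forest G" "m \<in> T" "m \<in> decs G" "c \<in> imm_succ G T m"
  shows "joint_act_to G (T, m) (T, c) \<in> joint_acts G (T, m)"
    and "move G m (joint_act_to G (T, m) (T, c)) = c"
proof -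
  have "c \<in> move G m ` joint_acts G (T, m)"
    using bij_move[OF assms(1-3)] assms(4) by (simp add: bij_betw_def)
  then show "joint_act_to G (T, m) (T, c) \<in> joint_acts G (T, m)"
    and "move G m (joint_act_to G (T, m) (T, c)) = c"
    unfolding joint_act_to_def snd_conv by (rule inv_into_into, rule f_inv_into_f)
qed

lemma joint_act_to_move:
  assumes "T \<in> forest G" "m \<in> T" "m \<in> decs G" "a \<in> joint_acts G (T, m)"
  shows "joint_act_to G (T, m) (T, move G m a) = a"
  using bij_move[OF assms(1-3)] assms(4) unfolding joint_act_to_def bij_betw_def
  by simp

section \<open>Paths and the precedence relation\<close>

lemma preceding_iff:
  "y \<in> preceding G (T, n) \<longleftrightarrow> (\<exists>m. y = (T, m) \<and> T \<in> forest G \<and> m \<in> T \<and> (m, n) \<in> prec G)"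
  by (cases y) (auto simp: preceding_def nodes_def)

lemma tree_path_prec:
  assumes "tree_path G xs"
  shows "fst (last xs) = fst (hd xs) \<and>
    (snd (hd xs) = snd (last xs) \<or> (snd (hd xs), snd (last xs)) \<in> prec G)"
  using assms
proof (induction xs)
  case Nil
  then show ?case by (simp add: tree_path_def)
next
  case (Cons x xs)
  show ?case
  proof (cases xs)
    case Nil
    then show ?thesis by simp
  next
    case (Cons y ys)
    then have "tree_path G xs" "fst y = fst x" "snd y \<in> imm_succ G (fst x) (snd x)"
      using Cons.prems by (auto simp: tree_path_def)
    moreover have "(snd x, snd y) \<in> prec G"
      using calculation(3) by (simp add: imm_succ_def)
    ultimately show ?thesis
      using Cons.IH Cons prec_trans by auto
  qed
qed

text \<open>Translates the path formulation of perfect recall into \<open>preceding\<close> and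
  \<open>joint_act_toward\<close>: the second node of the path is the immediate successor of
  \<open>x\<close> towards \<open>y\<close>.\<close>

lemma path_between_toward:
  assumes "path_between G x xs y" "x \<noteq> y"
  shows "x \<in> preceding G y" and "joint_act_to G x (xs ! 1) = joint_act_toward G x y"
proof -
  obtain ys where ys: "xs = x # ys"
    using assms unfolding path_between_def tree_path_def by (cases xs) auto
  with assms have "ys \<noteq> []"
    by (auto simp: path_between_def)
  then obtain c zs where xs: "xs = x # c # zs"
    using ys by (cases ys) auto
  have tp: "tree_path G (c # zs)" "fst c = fst x" "snd c \<in> imm_succ G (fst x) (snd x)"
    "x \<in> nodes G"
    using assms(1) xs by (auto simp: path_between_def tree_path_def)
  have l: "last (c # zs) = y"
    using assms(1) xs by (simp add: path_between_def)
  have y: "fst y = fst x" "snd c = snd y \<or> (snd c, snd y) \<in> prec G"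
    using tree_path_prec[OF tp(1)] tp(2) unfolding l by auto
  have "(snd x, snd y) \<in> prec G"
    using y tp(3) prec_trans unfolding imm_succ_def by auto
  with tp y show "x \<in> preceding G y"
    by (simp add: preceding_def)
  have "joint_act_toward G (fst x, snd x) (fst x, snd y) = joint_act_to G (fst x, snd x) (fst x, snd c)"
    by (rule joint_act_toward_eq[OF tp(3) y(2)])
  then show "joint_act_to G x (xs ! 1) = joint_act_toward G x y"
    using xs y(1) tp(2) by (metis nth_Cons_0 nth_Cons_Suc One_nat_def prod.collapse)
qed

lemma ex_path_between:
  assumes T: "T \<in> forest G" and n: "n \<in> T"
  shows "m \<in> T \<Longrightarrow> m = n \<or> (m, n) \<in> prec G \<Longrightarrow> \<exists>xs. path_between G (T, m) xs (T, n)"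
\<comment> \<open>The target \<open>n\<close> stays fixed and the start moves backwards:
  \<open>m\<close> is prepended to a path from its immediate successor towards
  \<open>n\<close>.\<close>
proof (induction m rule: wf_induct_rule[OF wf_prec_converse])
  case (1 m)
  show ?case
  proof (cases "m = n")
    case True
    then have "path_between G (T, m) [(T, m)] (T, n)"
      using T n by (simp add: path_between_def tree_path_def nodes_def)
    then show ?thesis ..
  next
    case False
    then have "(m, n) \<in> prec G" using 1 by simp
    then obtain c where c: "c \<in> imm_succ G T m" "c = n \<or> (c, n) \<in> prec G"
      using ex_toward[OF n] by blast
    then obtain xs where xs: "path_between G (T, c) xs (T, n)"
      using 1 unfolding imm_succ_def by auto
    then obtain ys where "xs = (T, c) # ys"
      unfolding path_between_def tree_path_def by (cases xs) auto
    with xs have "path_between G (T, m) ((T, m) # xs) (T, n)"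
      using c(1) T 1(2) by (auto simp: path_between_def tree_path_def nodes_def)
    then show ?thesis ..
  qed
qed

lemma preceding_ex_path:
  assumes "x \<in> preceding G y" "y \<in> nodes G"
  shows "\<exists>xs. path_between G x xs y"
  using assms ex_path_between by (cases y) (auto simp: preceding_iff nodes_def)

lemma preceding_neq: "x \<in> preceding G y \<Longrightarrow> x \<noteq> y"
  using prec_irrefl by (auto simp: preceding_def)

lemma active_nodes_subset: "active_nodes G j \<subseteq> nodes G"
  by (auto simp: active_nodes_def dec_nodes_def nodes_def)

lemma finite_own_preceding: "finite (own_preceding G i x)"
  using finite_nodes active_nodes_subset unfolding own_preceding_def
  by (meson finite_Int finite_subset)

subsection \<open>Reached nodes\<close>

text \<open>By (I2), (I4) applies in both directions between nodes of the information set, so the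
  \<open>THE\<close> in \<open>info_act\<close> has a unique solution. Only an inclusion results for
  \<open>x\<close>, which may lie outside its own information set.\<close>

lemma info_act_subset:
  assumes x: "x \<in> active_nodes G (Player j)"
  shows "info_act G j (info G j x) \<subseteq> act G (Player j) x"
proof -
  obtain y where y: "y \<in> info G j x" using info[OF x] by blast
  have eq: "act G (Player j) z = act G (Player j) y" if z: "z \<in> info G j x" for z
  proof
    have "y \<in> active_nodes G (Player j)" "z \<in> active_nodes G (Player j)"
      using info[OF x] y z by blast+
    then show "act G (Player j) z \<subseteq> act G (Player j) y" "act G (Player j) y \<subseteq> act G (Player j) z"
      using I2[OF x] I4 y z by metis+
  qed
  then have "info_act G j (info G j x) = act G (Player j) y"
    unfolding info_act_def using y by (intro the_equality) (metis eq)+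
  then show ?thesis using I4[OF x y] by simp
qed

text \<open>Guarantees that following a profile never leaves the tree: information sets located in
  another tree still prescribe actions available at \<open>n\<close> in \<open>T\<close>.\<close>

lemma prescribed_joint_acts:
  assumes s: "s \<in> opponent_profiles G i" and si: "si \<in> pure_strategies G i"
    and T: "T \<in> forest G" and n: "n \<in> T" "n \<in> decs G"
  shows "restrict (prescribed G (with_strategy i si s) (T, n)) (active G n) \<in> joint_acts G (T, n)"
  unfolding joint_acts_def snd_conv
proof (rule restrict_PiE_iff[THEN iffD2], rule ballI)
  fix j assume j: "j \<in> active G n"
  then have x: "(T, n) \<in> active_nodes G j"
    using T n by (simp add: active_nodes_def dec_nodes_def)
  show "prescribed G (with_strategy i si s) (T, n) j \<in> act G j (T, n)"
  proof (cases j)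
    case Nature
    then show ?thesis
      using s x unfolding opponent_profiles_def nature_strategies_def with_strategy_def by auto
  next
    case (Player k)
    then have "k \<in> players G" using active_players[OF n(2)] j by auto
    moreover have "snd s \<in> (\<Pi>\<^sub>E j\<in>players G - {i}. pure_strategies G j)"
      using s unfolding opponent_profiles_def by (simp add: mem_Times_iff)
    ultimately have "snd (with_strategy i si s) k \<in> pure_strategies G k"
      using si by (cases "k = i") (simp_all add: with_strategy_def PiE_mem)
    moreover have "info G k (T, n) \<in> info_sets G k"
      using x Player unfolding info_sets_def by blast
    ultimately have "snd (with_strategy i si s) k (info G k (T, n)) \<in> info_act G k (info G k (T, n))"
      unfolding pure_strategies_def by (rule PiE_mem)
    then show ?thesis
      using info_act_subset[of "(T, n)" k] x Player by (simp add: subset_iff)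
  qed
qed

lemma imm_succ_preceding:
  assumes "c \<in> imm_succ G T n" "m \<in> T" "(m, c) \<in> prec G"
  shows "m = n \<or> (m, n) \<in> prec G"
proof -
  have "(n, c) \<in> prec G" using assms(1) by (simp add: imm_succ_def)
  from prec_comparable[OF assms(3) this] show ?thesis
    using assms by (auto simp: imm_succ_def)
qed

text \<open>Induction on reaching. The feasibility premise makes each step land on an immediate
  successor, whose predecessors are the current node, where the prescribed joint action was just
  played, and earlier ones, covered by the induction hypothesis.\<close>

lemma reaches_imp_toward:
  assumes "\<And>T n. T \<in> forest G \<Longrightarrow> n \<in> T \<Longrightarrow> n \<in> decs G \<Longrightarrow>
      restrict (prescribed G s (T, n)) (active G n) \<in> joint_acts G (T, n)"
    and "reaches G s x"
  shows "x \<in> nodes G \<and>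
    (\<forall>y\<in>preceding G x. \<forall>j\<in>active G (snd y). prescribed G s y j = joint_act_toward G y x j)"
  using assms(2)
proof (induction rule: reaches.induct)
  case (root T n)
  then have "(m, n) \<notin> prec G" if "m \<in> T" for m
    using that prec_irrefl prec_asym unfolding is_root_def by metis
  then have "preceding G (T, n) = {}"
    by (auto simp: preceding_def nodes_def)
  with root show ?case by (auto simp: is_root_def nodes_def)
next
  case (step T n)
  let ?a = "restrict (prescribed G s (T, n)) (active G n)"
  let ?c = "move G n ?a"
  have T: "T \<in> forest G" "n \<in> T" using step by (auto simp: nodes_def)
  have a: "?a \<in> joint_acts G (T, n)" using assms(1) T step by blast
  then have c: "?c \<in> imm_succ G T n"
    using bij_move[OF T step(2)] unfolding bij_betw_def by blast
  have pc: "?c \<in> T" "(n, ?c) \<in> prec G" using c by (auto simp: imm_succ_def)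
  have "prescribed G s y j = joint_act_toward G y (T, ?c) j"
    if y: "y \<in> preceding G (T, ?c)" and j: "j \<in> active G (snd y)" for y j
  proof -
    obtain m where m: "y = (T, m)" "m \<in> T" "(m, ?c) \<in> prec G"
      using y by (auto simp: preceding_iff)
    consider "m = n" | "(m, n) \<in> prec G"
      using imm_succ_preceding[OF c m(2,3)] by blast
    then show ?thesis
    proof cases
      case 1
      have "joint_act_toward G y (T, ?c) = ?a"
        using joint_act_toward_eq[OF c, of ?c] joint_act_to_move[OF T step(2) a] m 1 by simp
      then show ?thesis using j m 1 by simp
    next
      case 2
      then have "y \<in> preceding G (T, n)" using m T by (simp add: preceding_iff)
      moreover have "joint_act_toward G y (T, ?c) = joint_act_toward G y (T, n)"
        using joint_act_toward_prec[OF T(2) 2 pc(2)] m by simp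
      ultimately show ?thesis using step j by simp
    qed
  qed
  with pc T show ?case by (auto simp: nodes_def)
qed

lemma toward_imp_reaches:
  assumes T: "T \<in> forest G"
  shows "n \<in> T \<Longrightarrow>
    (\<forall>y\<in>preceding G (T, n). \<forall>j\<in>active G (snd y).
       prescribed G s y j = joint_act_toward G y (T, n) j) \<Longrightarrow> reaches G s (T, n)"
proof (induction n rule: wf_induct_rule[OF wf_prec])
  case (1 n)
  show ?case
  proof (cases "is_root (prec G) T n")
    case True
    then show ?thesis using T by (rule reaches.root[rotated])
  next
    case False
    obtain r where "is_root (prec G \<inter> T \<times> T) T r"
      using forest_subtree[OF T] unfolding subtree_def rooted_tree_def by blast
    then have r: "is_root (prec G) T r"
      by (simp add: is_root_def)
    then have "r \<in> T" "(r, n) \<in> prec G"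
      using False 1(2) unfolding is_root_def by metis+
    then have "{m \<in> T. (m, n) \<in> prec G} \<noteq> {}" by blast
    \<comment> \<open>The last predecessor of \<open>n\<close> in \<open>T\<close>, hence the node
      of which \<open>n\<close> is an immediate successor.\<close>
    from prec_maximal[OF this] obtain m where m: "m \<in> T" "(m, n) \<in> prec G"
      "\<forall>k. (m, k) \<in> prec G \<longrightarrow> k \<notin> {m \<in> T. (m, n) \<in> prec G}"
      by (elim bexE CollectE conjE)
    then have n: "n \<in> imm_succ G T m"
      using 1(2) unfolding imm_succ_def by auto
    have md: "m \<in> decs G" using m prec_decs by blast
    have "prescribed G s y j = joint_act_toward G y (T, m) j"
      if y: "y \<in> preceding G (T, m)" and j: "j \<in> active G (snd y)" for y j
    proof -
      obtain k where k: "y = (T, k)" "k \<in> T" "(k, m) \<in> prec G"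
        using y by (auto simp: preceding_iff)
      then have "y \<in> preceding G (T, n)" using m T prec_trans by (auto simp: preceding_iff)
      then show ?thesis
        using 1(3) j joint_act_toward_prec[OF m(1) k(3) m(2)] k(1) by simp
    qed
    then have r: "reaches G s (T, m)" using 1(1) m by blast
    have t: "joint_act_toward G (T, m) (T, n) = joint_act_to G (T, m) (T, n)"
      using joint_act_toward_eq[OF n] by simp
    have "restrict (prescribed G s (T, m)) (active G m) = joint_act_to G (T, m) (T, n)"
    proof (rule PiE_ext)
      show "joint_act_to G (T, m) (T, n) \<in> (\<Pi>\<^sub>E j\<in>active G m. act G j (T, m))"
        using joint_act_to_succ(1)[OF T m(1) md n] by (simp add: joint_acts_def)
      have e: "prescribed G s (T, m) j = joint_act_to G (T, m) (T, n) j" if "j \<in> active G m" for j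
        using 1(3) that t m T by (auto simp: preceding_iff)
      with \<open>joint_act_to G (T, m) (T, n) \<in> _\<close>
      show "restrict (prescribed G s (T, m)) (active G m) \<in> (\<Pi>\<^sub>E j\<in>active G m. act G j (T, m))"
        by (auto simp: PiE_iff)
      show "restrict (prescribed G s (T, m)) (active G m) j = joint_act_to G (T, m) (T, n) j"
        if "j \<in> active G m" for j
        using e that by simp
    qed
    then show ?thesis
      using reaches.step[OF r md] joint_act_to_succ(2)[OF T m(1) md n] by simp
  qed
qed

lemma reaches_iff:
  assumes "s \<in> opponent_profiles G i" "si \<in> pure_strategies G i" "x \<in> nodes G"
  shows "reaches G (with_strategy i si s) x \<longleftrightarrow>
    (\<forall>y\<in>preceding G x. \<forall>j\<in>active G (snd y).
       prescribed G (with_strategy i si s) y j = joint_act_toward G y x j)"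
  using reaches_imp_toward[OF prescribed_joint_acts[OF assms(1,2)]]
    toward_imp_reaches[of "fst x" "snd x" "with_strategy i si s"] assms(3)
  by (auto simp: nodes_def)

lemma own_preceding_iff:
  "y \<in> own_preceding G i x \<longleftrightarrow> y \<in> preceding G x \<and> Player i \<in> active G (snd y)"
proof -
  have "y \<in> active_nodes G (Player i)" if "y \<in> preceding G x" "Player i \<in> active G (snd y)"
    using that prec_decs
    by (auto simp: preceding_def active_nodes_def dec_nodes_def nodes_def)
  then show ?thesis by (auto simp: own_preceding_def active_nodes_def)
qed

text \<open>Separates the variables: one conjunct involves only the opponents' profile
  \<open>s\<close>, the other only \<open>si\<close>. For fixed \<open>s\<close>, reaching
  \<open>x\<close> is thus either impossible or a cylinder event for
  \<open>\<sigma>\<close>.\<close>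

lemma reaches_iff_consistent:
  assumes "s \<in> opponent_profiles G i" "si \<in> pure_strategies G i" "x \<in> nodes G"
  shows "reaches G (with_strategy i si s) x \<longleftrightarrow>
    (\<forall>y\<in>preceding G x. \<forall>j\<in>active G (snd y) - {Player i}.
       prescribed G s y j = joint_act_toward G y x j) \<and> si \<in> consistent (experience G i x)"
proof -
  have o: "prescribed G (with_strategy i si s) y j = prescribed G s y j" if "j \<noteq> Player i" for y j
    using that by (cases j) (auto simp: with_strategy_def)
  have p: "prescribed G (with_strategy i si s) y (Player i) = si (info G i y)" for y
    by (simp add: with_strategy_def)
  have "si \<in> consistent (experience G i x) \<longleftrightarrow>
    (\<forall>y\<in>preceding G x. Player i \<in> active G (snd y) \<longrightarrow>
       si (info G i y) = joint_act_toward G y x (Player i))"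
    by (auto simp: consistent_def experience_def own_preceding_iff)
  then show ?thesis
    unfolding reaches_iff[OF assms] using o p by (metis Diff_iff singletonD singletonI)
qed

subsection \<open>Perfect recall\<close>

text \<open>Each pair in the experience at \<open>n\<close> is reproduced before \<open>x\<close> by
  perfect recall. The converse inclusion does not follow directly, since \<open>n\<close> may lie
  outside \<open>info G i n\<close>.\<close>

lemma experience_mono:
  assumes pr: "perfect_recall G i"
    and n: "n \<in> active_nodes G (Player i)" and x: "x \<in> info G i n"
  shows "experience G i n \<subseteq> experience G i x"
proof
  fix e assume "e \<in> experience G i n"
  then obtain y where y: "y \<in> preceding G n" "y \<in> active_nodes G (Player i)"
    "e = (info G i y, joint_act_toward G y n (Player i))"
    by (auto simp: experience_def own_preceding_def)
  obtain xs where xs: "path_between G y xs n"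
    using preceding_ex_path[OF y(1)] n active_nodes_subset by blast
  have ne: "y \<noteq> n" using preceding_neq[OF y(1)] .
  have "\<exists>x'\<in>active_nodes G (Player i). \<exists>xs'. x' \<noteq> x \<and> path_between G x' xs' x \<and>
    info G i x' = info G i y \<and>
    joint_act_to G x' (xs' ! 1) (Player i) = joint_act_to G y (xs ! 1) (Player i)"
    by (rule pr[unfolded perfect_recall_def, rule_format, OF y(2) n _ x])
      (use ne xs in blast)
  then obtain x' xs' where x': "x' \<in> active_nodes G (Player i)" "x' \<noteq> x" "path_between G x' xs' x"
    "info G i x' = info G i y"
    "joint_act_to G x' (xs' ! 1) (Player i) = joint_act_to G y (xs ! 1) (Player i)"
    by blast
  have "e = (info G i x', joint_act_toward G x' x (Player i))"
    using y(3) x' path_between_toward(2)[OF xs ne] path_between_toward(2)[OF x'(3,2)] by simp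
  with x' path_between_toward(1)[OF x'(3,2)] show "e \<in> experience G i x"
    by (auto simp: experience_def own_preceding_def)
qed

text \<open>Infinite descent: if the information set \<open>?h\<close> of \<open>x\<close> occurred
  before \<open>x\<close>, then by \<open>experience_mono\<close> it would occur before each of its
  own nodes, which contradicts well-foundedness of \<open>prec G\<close>.\<close>

lemma info_not_repeated:
  assumes pr: "perfect_recall G i"
    and x: "x \<in> active_nodes G (Player i)" and y: "y \<in> own_preceding G i x"
  shows "info G i y \<noteq> info G i x"
proof
  assume eq: "info G i y = info G i x"
  let ?h = "info G i x"
  have desc: "\<exists>z'\<in>?h. (snd z', snd z) \<in> prec G" if z: "z \<in> ?h" for z
  proof -
    have za: "z \<in> active_nodes G (Player i)" "info G i z = ?h"
      using info[OF x] I2[OF x z] z by auto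
    have "(info G i y, joint_act_toward G y x (Player i)) \<in> experience G i x"
      unfolding experience_def using y by (rule imageI)
    then have "(?h, joint_act_toward G y x (Player i)) \<in> experience G i z"
      using experience_mono[OF pr x z] eq by auto
    then obtain z' where z': "z' \<in> preceding G z" "z' \<in> active_nodes G (Player i)"
      "info G i z' = ?h"
      by (auto simp: experience_def own_preceding_def)
    \<comment> \<open>Having information set \<open>?h\<close> does not by itself put
      \<open>z'\<close> into \<open>?h\<close>. Since \<open>?h\<close> lies in the single tree
      \<open>T\<close>, which therefore also contains \<open>z'\<close>, (U1) applied to
      \<open>z'\<close> does.\<close>
    obtain T where T: "T \<in> forest G" "in_tree ?h T"
      using U0[OF za(1)] za(2) by auto
    have "fst z' = T" using T(2) z z'(1) by (auto simp: in_tree_def preceding_def)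
    moreover have "(T, snd z') \<in> ?h" using U1[OF z'(2) T(1)] T(2) z'(3) by simp
    ultimately have "z' \<in> ?h" by auto
    then show ?thesis using z'(1) by (auto simp: preceding_def)
  qed
  have "snd ` ?h \<noteq> {}" using info[OF x] by simp
  from prec_minimal[OF this]
  obtain m where "m \<in> snd ` ?h" "\<forall>k. (k, m) \<in> prec G \<longrightarrow> k \<notin> snd ` ?h"
    by (rule bexE)
  then show False using desc by blast
qed

text \<open>Two own predecessors of \<open>x\<close> are comparable, so distinct ones have different
  information sets by \<open>info_not_repeated\<close>.\<close>

lemma card_experience:
  assumes pr: "perfect_recall G i"
  shows "card (experience G i x) = card (own_preceding G i x)"
  unfolding experience_def
proof (rule card_image, rule inj_onI)
  fix y z
  assume y: "y \<in> own_preceding G i x" and z: "z \<in> own_preceding G i x"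
    and eq: "(info G i y, joint_act_toward G y x (Player i)) =
      (info G i z, joint_act_toward G z x (Player i))"
  have yz: "fst y = fst z" "(snd y, snd x) \<in> prec G" "(snd z, snd x) \<in> prec G"
    "y \<in> active_nodes G (Player i)" "z \<in> active_nodes G (Player i)"
    "y \<in> nodes G" "z \<in> nodes G"
    using y z by (auto simp: own_preceding_def preceding_def)
  consider "snd y = snd z" | "(snd y, snd z) \<in> prec G" | "(snd z, snd y) \<in> prec G"
    using prec_comparable[OF yz(2,3)] by blast
  then show "y = z"
  proof cases
    case 1
    with yz(1) show ?thesis by (simp add: prod_eq_iff)
  next
    case 2
    then have "y \<in> own_preceding G i z" using yz by (simp add: own_preceding_def preceding_def)
    then show ?thesis using info_not_repeated[OF pr yz(5)] eq by (metis prod.inject)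
  next
    case 3
    then have "z \<in> own_preceding G i y" using yz by (simp add: own_preceding_def preceding_def)
    then show ?thesis using info_not_repeated[OF pr yz(4)] eq by (metis prod.inject)
  qed
qed

text \<open>The witness is the copy of \<open>n\<close> in a tree below that contains the
  information set. Perfect recall bounds its experience from below, and counting own predecessors
  bounds its size from above.\<close>

lemma experience_info_copy:
  assumes pr: "perfect_recall G i" and n: "n \<in> active_nodes G (Player i)"
  shows "\<exists>x\<in>info G i n. experience G i n = experience G i x"
proof -
  obtain T where T: "T \<in> forest G" "T \<subseteq> fst n" "in_tree (info G i n) T"
    using U0[OF n] by blast
  let ?x = "(T, snd n)"
  have x: "?x \<in> info G i n" using U1[OF n T(1,3)] by blast
  have nf: "fst n \<in> forest G"
    using n by (auto simp: active_nodes_def dec_nodes_def)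
  have "card (own_preceding G i ?x) \<le> card (own_preceding G i n)"
  proof (rule card_inj_on_le)
    \<comment> \<open>Own predecessors of the copy are lifted back to the tree of \<open>n\<close>,
      which is possible because \<open>T \<subseteq> fst n\<close> while \<open>prec\<close> and
      \<open>active\<close> refer to base nodes.\<close>
    show "inj_on (\<lambda>y. (fst n, snd y)) (own_preceding G i ?x)"
      by (auto simp: inj_on_def own_preceding_def preceding_def)
    show "(\<lambda>y. (fst n, snd y)) ` own_preceding G i ?x \<subseteq> own_preceding G i n"
      using T nf by (auto simp: own_preceding_iff preceding_def nodes_def)
  qed (rule finite_own_preceding)
  then have "card (experience G i ?x) \<le> card (experience G i n)"
    by (simp add: card_experience[OF pr])
  then have "experience G i n = experience G i ?x"
    using card_seteq[of "experience G i ?x" "experience G i n"] experience_mono[OF pr n x]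
      finite_own_preceding by (simp add: experience_def)
  with x show ?thesis by blast
qed

text \<open>After passing to representatives inside the common information set,
  \<open>experience_mono\<close> applies in both directions. Hence experience is a function of the
  information set.\<close>

lemma experience_info_cong:
  assumes pr: "perfect_recall G i"
    and m: "m \<in> active_nodes G (Player i)" and n: "n \<in> active_nodes G (Player i)"
    and eq: "info G i m = info G i n"
  shows "experience G i m = experience G i n"
proof -
  obtain x y where x: "x \<in> info G i m" "experience G i m = experience G i x"
    and y: "y \<in> info G i n" "experience G i n = experience G i y"
    using experience_info_copy[OF pr] m n by metis
  have "x \<in> active_nodes G (Player i)" "y \<in> active_nodes G (Player i)"
    "info G i x = info G i n" "info G i y = info G i n"
    using info[OF m] info[OF n] I2[OF m x(1)] I2[OF n y(1)] x(1) y(1) eq by auto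
  then have "experience G i x \<subseteq> experience G i y" "experience G i y \<subseteq> experience G i x"
    using experience_mono[OF pr] x(1) y(1) eq by auto
  with x y show ?thesis by simp
qed

subsection \<open>The behavior strategy\<close>

text \<open>Own predecessors form a chain, so the latest one can be split off. This is the induction
  step of the telescoping product.\<close>

lemma last_own_preceding:
  assumes x: "x \<in> nodes G" and ne: "own_preceding G i x \<noteq> {}"
  obtains y where "y \<in> active_nodes G (Player i)" "y \<in> preceding G x" "y \<notin> own_preceding G i y"
    "own_preceding G i x = insert y (own_preceding G i y)"
    "\<And>z. z \<in> own_preceding G i y \<Longrightarrow> joint_act_toward G z x = joint_act_toward G z y"
proof -
  have "snd ` own_preceding G i x \<noteq> {}" using ne by simp
  from prec_maximal[OF this] obtain m where m: "m \<in> snd ` own_preceding G i x"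
    "\<forall>k. (m, k) \<in> prec G \<longrightarrow> k \<notin> snd ` own_preceding G i x"
    by (rule bexE)
  then obtain y where y: "y \<in> own_preceding G i x" "m = snd y" by blast
  have ya: "y \<in> active_nodes G (Player i)" "y \<in> preceding G x"
    using y(1) by (auto simp: own_preceding_def)
  have yx: "fst y = fst x" "(snd y, snd x) \<in> prec G"
    using ya(2) unfolding preceding_def by blast+
  have yT: "snd y \<in> fst y"
    using ya(2) by (cases y) (simp add: preceding_def nodes_def)
  have le: "z \<in> own_preceding G i x \<longleftrightarrow> z = y \<or> z \<in> own_preceding G i y" for z
  proof
    assume z: "z \<in> own_preceding G i x"
    then have zx: "fst z = fst x" "(snd z, snd x) \<in> prec G"
      unfolding own_preceding_def preceding_def by blast+
    have "(snd y, snd z) \<notin> prec G"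
      using m(2) y(2) z by blast
    then have "snd z = snd y \<or> (snd z, snd y) \<in> prec G"
      using prec_comparable[OF zx(2) yx(2)] by blast
    moreover have "z \<in> own_preceding G i y" if "(snd z, snd y) \<in> prec G"
      using z zx(1) yx(1) that unfolding own_preceding_def preceding_def by simp
    ultimately show "z = y \<or> z \<in> own_preceding G i y"
      using zx(1) yx(1) by (metis prod.expand)
  next
    assume "z = y \<or> z \<in> own_preceding G i y"
    then show "z \<in> own_preceding G i x"
    proof
      assume z: "z \<in> own_preceding G i y"
      then have "(snd z, snd x) \<in> prec G"
        using prec_trans[OF _ yx(2)] unfolding own_preceding_def preceding_def by blast
      then show ?thesis
        using z yx(1) unfolding own_preceding_def preceding_def by simp
    qed (simp add: y(1))
  qed
  show ?thesis
  proof (rule that[OF ya])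
    show "y \<notin> own_preceding G i y"
      using preceding_neq unfolding own_preceding_def by blast
    show "own_preceding G i x = insert y (own_preceding G i y)"
      using le by (simp add: set_eq_iff)
    fix z assume "z \<in> own_preceding G i y"
    then have z: "fst z = fst y" "(snd z, snd y) \<in> prec G"
      unfolding own_preceding_def preceding_def by blast+
    have "joint_act_toward G (fst y, snd z) (fst y, snd x) =
        joint_act_toward G (fst y, snd z) (fst y, snd y)"
      by (rule joint_act_toward_prec[OF yT z(2) yx(2)])
    moreover have "(fst y, snd z) = z" "(fst y, snd x) = x"
      using z(1) yx(1) by (simp_all add: prod_eq_iff)
    ultimately show "joint_act_toward G z x = joint_act_toward G z y"
      by simp
  qed
qed

text \<open>The premise on \<open>\<beta>\<close> is the multiplication rule for conditional
  probabilities, stated without division so that it also covers null events. Splitting off the last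
  own predecessor adds one pair to the experience and one factor to the product; the empty product
  matches \<open>consistent {} = UNIV\<close>.\<close>

lemma prod_conditional_eq:
  assumes \<beta>: "\<And>y a. y \<in> active_nodes G (Player i) \<Longrightarrow>
      measure_pmf.prob \<sigma> (consistent (experience G i y)) * pmf (\<beta> (info G i y)) a =
      measure_pmf.prob \<sigma> (consistent (insert (info G i y, a) (experience G i y)))"
    and "x \<in> nodes G"
  shows "(\<Prod>y\<in>own_preceding G i x. pmf (\<beta> (info G i y)) (joint_act_toward G y x (Player i))) =
    measure_pmf.prob \<sigma> (consistent (experience G i x))"
  using assms(2)
proof (induction "card (own_preceding G i x)" arbitrary: x)
  case 0
  then have "own_preceding G i x = {}" using finite_own_preceding by simp
  then show ?case by (simp add: experience_def)
next
  case (Suc k)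
  let ?p = "\<lambda>y x. pmf (\<beta> (info G i y)) (joint_act_toward G y x (Player i))"
  have "own_preceding G i x \<noteq> {}" using Suc(2) by auto
  from last_own_preceding[OF Suc(3) this] obtain y where
    y: "y \<in> active_nodes G (Player i)" "y \<notin> own_preceding G i y"
      "own_preceding G i x = insert y (own_preceding G i y)"
    and t: "\<And>z. z \<in> own_preceding G i y \<Longrightarrow> joint_act_toward G z x = joint_act_toward G z y"
    by metis
  have "k = card (own_preceding G i y)" using Suc(2) y finite_own_preceding by simp
  then have IH: "(\<Prod>z\<in>own_preceding G i y. ?p z y) =
      measure_pmf.prob \<sigma> (consistent (experience G i y))"
    using Suc(1) y(1) active_nodes_subset by blast
  have e: "experience G i x =
      insert (info G i y, joint_act_toward G y x (Player i)) (experience G i y)"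
    unfolding experience_def y(3) using t by auto
  have "(\<Prod>z\<in>own_preceding G i x. ?p z x) = (\<Prod>z\<in>own_preceding G i y. ?p z x) * ?p y x"
    using y finite_own_preceding by (simp add: mult.commute)
  also have "(\<Prod>z\<in>own_preceding G i y. ?p z x) = (\<Prod>z\<in>own_preceding G i y. ?p z y)"
    using t by simp
  finally show ?case using IH \<beta>[OF y(1)] e by simp
qed

end

text \<open>The multiplication rule for the image of a conditioned distribution.
  \<open>cond_pmf\<close> is meaningful only if the event meets the support; in the remaining case
  both sides vanish, whatever default is chosen.\<close>

lemma prob_mult_pmf_map_cond:
  defines "q \<equiv> \<lambda>p :: 'a pmf. \<lambda>C. if set_pmf p \<inter> C = {} then p else cond_pmf p C"
  shows "measure_pmf.prob p C * pmf (map_pmf f (q p C)) a =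
    measure_pmf.prob p (C \<inter> {s. f s = a})"
proof (cases "set_pmf p \<inter> C = {}")
  case True
  then have "measure_pmf.prob p C = 0" by (simp add: measure_pmf_zero_iff)
  moreover have "measure_pmf.prob p (C \<inter> {s. f s = a}) = 0"
    using True by (auto simp: measure_pmf_zero_iff)
  ultimately show ?thesis by simp
next
  case False
  have "pmf (map_pmf f (q p C)) a = measure_pmf.prob (cond_pmf p C) (f -` {a})"
    using False by (simp add: q_def pmf_map)
  also have "\<dots> = measure_pmf.prob p (C \<inter> f -` {a}) / measure_pmf.prob p C"
    using emeasure_measure_pmf_not_zero[OF False]
    by (simp add: cond_pmf.rep_eq[OF False] measure_uniform_measure)
  finally show ?thesis
    using False by (simp add: measure_pmf_zero_iff vimage_def)
qed

theorem theorem1: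
  fixes G :: "('p, 'v, 'a) ugame" and i :: 'p
  assumes "unawareness_game G"
    and "i \<in> players G"
    and "perfect_recall G i"
  shows "\<forall>\<sigma>\<in>mixed_strategies G i. \<exists>\<beta>\<in>behavior_strategies G i. equivalent_strategies G i \<sigma> \<beta>"
proof
  interpret unawareness_game G by fact
  fix \<sigma> assume \<sigma>: "\<sigma> \<in> mixed_strategies G i"
  \<comment> \<open>\<open>inv_into\<close> selects some node with information set \<open>h\<close>;
    by \<open>experience_info_cong\<close> the choice does not matter.\<close>
  define E where "E h = experience G i (inv_into (active_nodes G (Player i)) (info G i) h)" for h
  \<comment> \<open>The default \<open>\<sigma>\<close> keeps the support of \<open>q h\<close>
    inside the pure strategies, so that \<open>\<beta> h\<close> is a mixed action at
    \<open>h\<close> even when its experience has probability zero.\<close>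
  define q where "q h = (if set_pmf \<sigma> \<inter> consistent (E h) = {} then \<sigma>
    else cond_pmf \<sigma> (consistent (E h)))" for h
  define \<beta> where "\<beta> = (\<lambda>h\<in>info_sets G i. map_pmf (\<lambda>s. s h) (q h))"
  have E: "E (info G i y) = experience G i y" if "y \<in> active_nodes G (Player i)" for y
    unfolding E_def using that
    by (intro experience_info_cong assms(3) inv_into_into f_inv_into_f) auto
  have "\<beta> \<in> behavior_strategies G i"
    unfolding behavior_strategies_def
  proof (rule PiE_I)
    fix h assume h: "h \<in> info_sets G i"
    have "set_pmf (q h) \<subseteq> pure_strategies G i"
      using \<sigma> set_cond_pmf[of \<sigma> "consistent (E h)"]
      unfolding q_def mixed_strategies_def by auto
    then show "\<beta> h \<in> {p. set_pmf p \<subseteq> info_act G i h}"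
      using h unfolding \<beta>_def pure_strategies_def by auto
  qed (simp add: \<beta>_def)
  moreover have "equivalent_strategies G i \<sigma> \<beta>"
    unfolding equivalent_strategies_def
  proof (intro ballI)
    fix x s assume x: "x \<in> nodes G" and s: "s \<in> opponent_profiles G i"
    let ?bad = "\<exists>y\<in>preceding G x. \<exists>j\<in>active G (snd y) - {Player i}.
      prescribed G s y j \<noteq> joint_act_toward G y x j"
    have "measure_pmf.prob \<sigma> (consistent (experience G i y)) * pmf (\<beta> (info G i y)) a =
        measure_pmf.prob \<sigma> (consistent (insert (info G i y, a) (experience G i y)))"
      if y: "y \<in> active_nodes G (Player i)" for y a
      using prob_mult_pmf_map_cond[of \<sigma> "consistent (experience G i y)" "\<lambda>s. s (info G i y)" a]
        y E[OF y] by (simp add: \<beta>_def q_def info_sets_def consistent_insert cong: if_cong split del: if_split)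
    from prod_conditional_eq[OF this x]
    have b: "reach_behavior G i \<beta> s x =
        (if ?bad then 0 else measure_pmf.prob \<sigma> (consistent (experience G i x)))"
      by (simp add: reach_behavior_def own_preceding_def)
    have "reach_mixed G i \<sigma> s x =
        measure_pmf.prob \<sigma> {si. \<not> ?bad \<and> si \<in> consistent (experience G i x)}"
      unfolding reach_mixed_def
    \<comment> \<open>The two events differ only outside \<open>pure_strategies G i\<close>, a null
      set for \<open>\<sigma>\<close>.\<close>
    proof (rule measure_pmf.finite_measure_eq_AE)
      show "AE si in measure_pmf \<sigma>.
        (si \<in> {si \<in> pure_strategies G i. reaches G (with_strategy i si s) x}) =
        (si \<in> {si. \<not> ?bad \<and> si \<in> consistent (experience G i x)})"
        using \<sigma> reaches_iff_consistent[OF s _ x]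
        by (auto simp: AE_measure_pmf_iff mixed_strategies_def)
    qed simp_all
    then show "reach_mixed G i \<sigma> s x = reach_behavior G i \<beta> s x"
      unfolding b by (cases ?bad) auto
  qed
  ultimately show "\<exists>\<beta>\<in>behavior_strategies G i. equivalent_strategies G i \<sigma> \<beta>" by blast
qed

end
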